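(* Let $P_1,\dots,P_n$ be discrete probability measures on $\mathbb{R}^d$ and let $\lambda\in\mathbb{R}^n$ be a strictly positive weight vector with $\sum_{i=1}^n\lambda_i=1$. The Discrete Barycenter Problem for $P_1,\dots,P_n$ and $\lambda$ can be solved using the following linear program (called LP (general)) in the variables $w_h$ ($h=1,\dots,|S^*|$): $$\begin{array}{rll} \min & \sum_{h=1}^{|S^*|}c_hw_h & \\ \text{s.t.} & \sum_{h\in S^*_{ij}}w_h=d_{ij}, & \forall i=1,\dots,n,\ \forall j=1,\dots,|P_i|,\\ & w_h\ge0, & \forall h=1,\dots,|S^*|. \end{array}$$ Moreover, any optimal vertex of this linear program corresponds to a sparse barycenter.
   Context: Discrete measures: each $P_i$ is a probability measure on $\mathbb{R}^d$ with finite support $\mathrm{supp}(P_i)=\{\mathbf{x}_{ij} : j=1,\dots,|P_i|\}$ (distinct points; $|P_i|$ denotes the number of support points), with mass $d_{ij}>0$ at $\mathbf{x}_{ij}$ and $\sum_{j=1}^{|P_i|}d_{ij}=1$. Barycenter: $W_2$ denotes the quadratic Wasserstein distance, $W_2(\mu,\nu)^2=\inf_{\gamma\in\Pi(\mu,\nu)}\int\|x-y\|^2\,d\gamma(x,y)$, where $\Pi(\mu,\nu)$ is the set of measures on $\mathbb{R}^d\times\mathbb{R}^d$ with marginals $\mu,\nu$. A (discrete) barycenter of $P_1,\dots,P_n$ with weights $\lambda$ is a probability measure $\bar P$ on $\mathbb{R}^d$ minimizing $\sum_{i=1}^n\lambda_iW_2(P,P_i)^2$ over all probability measures $P$ on $\mathbb{R}^d$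 with finite second moments. The Discrete Barycenter Problem asks, given $P_1,\dots,P_n$ and $\lambda$, for a barycenter. Sparse: a barycenter $\bar P$ is called sparse if $|\mathrm{supp}(\bar P)|\le\left(\sum_{i=1}^n|P_i|\right)-n+1$. Tuples: $S^*=\mathrm{supp}(P_1)\times\dots\times\mathrm{supp}(P_n)=\{s^*_1,\dots,s^*_{|S^*|}\}$. For $s^*_h=(\mathbf{x}_{1j_1},\dots,\mathbf{x}_{nj_n})$ let $\mathbf{m}_h=\sum_{i=1}^n\lambda_i\mathbf{x}_{ij_i}$ be its weighted mean and $c_h=\sum_{i=1}^n\lambda_i\|\mathbf{m}_h-\mathbf{x}_{ij_i}\|^2$ its cost. $S^*_{ij}$ is the set of indices $h$ such that the $i$-th component of $s^*_h$ is $\mathbf{x}_{ij}$. Meaning of the statement: "can be solved using the LP" means that the LP has an optimal solution and that for every optimal solution $w$ the measure $\bar P=\sum_{h=1}^{|S^*|}w_h\delta_{\mathbf{m}_h}$ is a barycenter. An optimal vertex $w$ (an optimal solution that is a vertex of the feasible polyhedron) corresponds to the measure $\sum_hw_h\delta_{\mathbf{m}_h}$. *)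

theory Defs
  imports
    "HOL-Probability.Probability"
    "HOL-Analysis.Finite_Function_Topology"
begin

section \<open>Discrete measures and barycenters\<close>

definition supp :: "'a::topological_space measure \<Rightarrow> 'a set" where
  "supp M = {x. \<forall>U. open U \<longrightarrow> x \<in> U \<longrightarrow> 0 < emeasure M U}"

definition borel_prob :: "'a::topological_space measure \<Rightarrow> bool" where
  "borel_prob M \<longleftrightarrow> prob_space M \<and> sets M = sets borel"

definition discrete_prob :: "'a::topological_space measure \<Rightarrow> bool" where
  "discrete_prob M \<longleftrightarrow> borel_prob M \<and> finite (supp M)"

definition couplings ::
    "'a::topological_space measure \<Rightarrow> 'a measure \<Rightarrow> ('a \<times> 'a) measure set" where
  "couplings \<mu> \<nu> = {\<gamma>. sets \<gamma> = sets (borel \<Otimes>\<^sub>M borel) \<and>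
     distr \<gamma> borel fst = \<mu> \<and> distr \<gamma> borel snd = \<nu>}"

text \<open>The squared quadratic Wasserstein distance, with values in the extended nonnegative reals.\<close>

definition wasserstein2_sq :: "'a::euclidean_space measure \<Rightarrow> 'a measure \<Rightarrow> ennreal" where
  "wasserstein2_sq \<mu> \<nu> =
     (INF \<gamma>\<in>couplings \<mu> \<nu>. \<integral>\<^sup>+ (x, y). ennreal ((norm (x - y))\<^sup>2) \<partial>\<gamma>)"

definition finite_second_moment :: "'a::euclidean_space measure \<Rightarrow> bool" where
  "finite_second_moment M \<longleftrightarrow> (\<integral>\<^sup>+ x. ennreal ((norm x)\<^sup>2) \<partial>M) < \<infinity>"

definition barycenter ::
    "nat \<Rightarrow> (nat \<Rightarrow> real) \<Rightarrow> (nat \<Rightarrow> 'a::euclidean_space measure) \<Rightarrow> 'a measure \<Rightarrow> bool" where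
  "barycenter n lam P Q \<longleftrightarrow>
     is_arg_min (\<lambda>Q. \<Sum>i<n. ennreal (lam i) * wasserstein2_sq Q (P i))
       (\<lambda>Q. borel_prob Q \<and> finite_second_moment Q) Q"

definition sparse_barycenter ::
    "nat \<Rightarrow> (nat \<Rightarrow> real) \<Rightarrow> (nat \<Rightarrow> 'a::euclidean_space measure) \<Rightarrow> 'a measure \<Rightarrow> bool" where
  "sparse_barycenter n lam P Q \<longleftrightarrow> barycenter n lam P Q \<and> finite (supp Q) \<and>
     int (card (supp Q)) \<le> (\<Sum>i<n. int (card (supp (P i)))) - int n + 1"

section \<open>The linear program\<close>

text \<open>
  The variables of the linear program are indexed directly by the tuples of support points,
  rather than by an enumeration of them; likewise the constraints are indexed by \<open>i\<close> and a
  support point \<open>x\<close> of \<open>P i\<close>, whose mass is \<open>measure (P i) {x}\<close>.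
\<close>

definition tuples :: "nat \<Rightarrow> (nat \<Rightarrow> 'a::topological_space measure) \<Rightarrow> (nat \<Rightarrow> 'a) set" where
  "tuples n P = (\<Pi>\<^sub>E i\<in>{..<n}. supp (P i))"

definition weighted_mean :: "nat \<Rightarrow> (nat \<Rightarrow> real) \<Rightarrow> (nat \<Rightarrow> 'a::euclidean_space) \<Rightarrow> 'a" where
  "weighted_mean n lam s = (\<Sum>i<n. lam i *\<^sub>R s i)"

definition tuple_cost :: "nat \<Rightarrow> (nat \<Rightarrow> real) \<Rightarrow> (nat \<Rightarrow> 'a::euclidean_space) \<Rightarrow> real" where
  "tuple_cost n lam s = (\<Sum>i<n. lam i * (norm (weighted_mean n lam s - s i))\<^sup>2)"

definition tuples_at ::
    "nat \<Rightarrow> (nat \<Rightarrow> 'a::topological_space measure) \<Rightarrow> nat \<Rightarrow> 'a \<Rightarrow> (nat \<Rightarrow> 'a) set" where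
  "tuples_at n P i x = {s \<in> tuples n P. s i = x}"

text \<open>
  The space of real vectors indexed by \<open>tuples n P\<close> is represented by the finitely supported
  functions that vanish outside \<open>tuples n P\<close>; these live in a \<^class>\<open>real_vector\<close>, so that
  vertices of the feasible polyhedron are its extreme points in the sense of
  \<^const>\<open>extreme_point_of\<close>.
\<close>

definition lp_feasible ::
    "nat \<Rightarrow> (nat \<Rightarrow> 'a::topological_space measure) \<Rightarrow> ((nat \<Rightarrow> 'a) \<Rightarrow>\<^sub>0 real) set" where
  "lp_feasible n P = {w. Poly_Mapping.keys w \<subseteq> tuples n P \<and>
     (\<forall>i<n. \<forall>x\<in>supp (P i). (\<Sum>s\<in>tuples_at n P i x. Poly_Mapping.lookup w s) = measure (P i) {x}) \<and>
     (\<forall>s\<in>tuples n P. 0 \<le> Poly_Mapping.lookup w s)}"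

definition lp_objective ::
    "nat \<Rightarrow> (nat \<Rightarrow> real) \<Rightarrow> (nat \<Rightarrow> 'a::euclidean_space measure) \<Rightarrow>
     ((nat \<Rightarrow> 'a) \<Rightarrow>\<^sub>0 real) \<Rightarrow> real" where
  "lp_objective n lam P w = (\<Sum>s\<in>tuples n P. tuple_cost n lam s * Poly_Mapping.lookup w s)"

definition lp_optimal ::
    "nat \<Rightarrow> (nat \<Rightarrow> real) \<Rightarrow> (nat \<Rightarrow> 'a::euclidean_space measure) \<Rightarrow>
     ((nat \<Rightarrow> 'a) \<Rightarrow>\<^sub>0 real) \<Rightarrow> bool" where
  "lp_optimal n lam P w \<longleftrightarrow> is_arg_min (lp_objective n lam P) (\<lambda>w. w \<in> lp_feasible n P) w"

text \<open>
  The sum of the point masses \<open>w s\<close> at \<open>weighted_mean n lam s\<close>, as the push-forward of the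
  measure on tuples that gives mass \<open>w s\<close> to \<open>s\<close>.
\<close>

definition lp_measure ::
    "nat \<Rightarrow> (nat \<Rightarrow> real) \<Rightarrow> (nat \<Rightarrow> 'a::euclidean_space measure) \<Rightarrow>
     ((nat \<Rightarrow> 'a) \<Rightarrow>\<^sub>0 real) \<Rightarrow> 'a measure" where
  "lp_measure n lam P w =
     distr (point_measure (tuples n P) (\<lambda>s. ennreal (Poly_Mapping.lookup w s)))
       borel (weighted_mean n lam)"

lemma emeasure_lp_measure:
  assumes "finite (tuples n P)" and "A \<in> sets borel"
  shows "emeasure (lp_measure n lam P w) A =
    (\<Sum>s\<in>tuples n P. ennreal (Poly_Mapping.lookup w s) * indicator A (weighted_mean n lam s))"
proof -
  have "emeasure (lp_measure n lam P w) A =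
      (\<Sum>s\<in>weighted_mean n lam -` A \<inter> tuples n P. ennreal (Poly_Mapping.lookup w s))"
    unfolding lp_measure_def using assms
    by (subst emeasure_distr)
      (auto simp: space_point_measure emeasure_point_measure_finite measurable_point_measure_eq1)
  also have "\<dots> = (\<Sum>s\<in>tuples n P.
      ennreal (Poly_Mapping.lookup w s) * indicator A (weighted_mean n lam s))"
    using assms by (intro sum.mono_neutral_cong_left) (auto simp: indicator_def)
  finally show ?thesis .
qed

text \<open>The support of a discrete measure carries all the mass, and consists of atoms.\<close>

lemma discrete_prob_supp:
  fixes M :: "'a::euclidean_space measure"
  assumes "discrete_prob M"
  shows "emeasure M (supp M) = 1" and "x \<in> supp M \<Longrightarrow> 0 < measure M {x}"
    and "(\<Sum>x\<in>supp M. measure M {x}) = 1"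
proof -
  interpret prob_space M
    using assms by (simp add: discrete_prob_def borel_prob_def)
  have sets: "sets M = sets borel" and fin: "finite (supp M)"
    using assms by (auto simp: discrete_prob_def borel_prob_def)
  define \<U> where "\<U> = {U. open U \<and> emeasure M U = 0}"
  have compl: "- supp M = \<Union>\<U>"
    by (auto simp: supp_def \<U>_def)
  obtain \<V> where \<V>: "\<V> \<subseteq> \<U>" "countable \<V>" "\<Union>\<V> = \<Union>\<U>"
    using Lindelof[of \<U>] by (auto simp: \<U>_def)
  have "(\<Union>V\<in>\<V>. V) \<in> null_sets M"
    using \<V> by (intro null_sets_UN') (auto simp: \<U>_def null_sets_def sets)
  then have null: "emeasure M (- supp M) = 0"
    using compl \<V> by auto
  have meas: "supp M \<in> sets M"
    using fin sets by (simp add: finite_imp_closed)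
  have sp: "space M = UNIV"
    using sets_eq_imp_space_eq[OF sets] by simp
  have "prob (space M - supp M) = 0"
    using null sp by (simp add: measure_def Compl_eq_Diff_UNIV)
  then have p1: "prob (supp M) = 1"
    using prob_compl[OF meas] by simp
  then show "emeasure M (supp M) = 1"
    by (simp add: emeasure_eq_measure)
  show "(\<Sum>x\<in>supp M. measure M {x}) = 1"
    using finite_measure_eq_sum_singleton[OF fin] sets p1 by simp
  show "0 < measure M {x}" if x: "x \<in> supp M"
  proof -
    have op: "open (- (supp M - {x}))"
      using fin by (intro open_Compl finite_imp_closed) auto
    have "0 < emeasure M (- (supp M - {x}))"
      using x op by (auto simp: supp_def)
    also have "- (supp M - {x}) = - supp M \<union> {x}"
      using x by auto
    also have "emeasure M (- supp M \<union> {x}) \<le> emeasure M (- supp M) + emeasure M {x}"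
      using meas sets by (intro emeasure_subadditive) (auto simp: fin finite_imp_closed open_Compl)
    finally show ?thesis
      using null by (simp add: emeasure_eq_measure)
  qed
qed

end

theory Submission
  imports Defs
begin

text \<open>
  A feasible \<open>w\<close> is a joint distribution of the \<open>P i\<close>; sending a tuple to its weighted mean couples
  \<open>lp_measure\<close> with each \<open>P i\<close>, so the barycenter objective of \<open>lp_measure\<close> is at most the LP objective
  of \<open>w\<close>. Conversely, couplings of an arbitrary \<open>Q\<close> with the \<open>P i\<close> disintegrate over \<open>Q\<close>, since the
  \<open>P i\<close> have finite support: Radon--Nikodym densities give conditional distributions \<open>f i _ x\<close>. Gluing
  them, \<open>w s = \<integral> (\<Prod>i. f i (s i) x) \<partial>Q\<close>, yields a feasible \<open>w\<close> whose LP objective does not exceed the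
  transport cost, because the weighted mean minimises \<open>z \<mapsto> \<Sum>i. lam i * (norm (z - s i))\<^sup>2\<close>. Finally, a
  vertex has at most as many nonzero entries as there are independent constraints, for otherwise it
  can be perturbed in both directions along a kernel vector.
\<close>

section \<open>Product sums, homogeneous linear systems and the variance identity\<close>

text \<open>Fixing coordinate \<open>i\<close> shrinks one factor of the product set to a singleton,
  so the sum still factorises, and every other factor is 1. This is the marginal of a product
  distribution.\<close>

lemma sum_prod_PiE_coordinate:
  fixes f :: "'i \<Rightarrow> 'b \<Rightarrow> 'c::comm_semiring_1"
  assumes "finite I" "\<And>k. k \<in> I \<Longrightarrow> finite (S k)" "i \<in> I" "x \<in> S i"
    and one: "\<And>k. k \<in> I \<Longrightarrow> (\<Sum>y\<in>S k. f k y) = 1"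
  shows "(\<Sum>s\<in>{s \<in> Pi\<^sub>E I S. s i = x}. \<Prod>k\<in>I. f k (s k)) = f i x"
proof -
  let ?S = "S(i := {x})"
  have "{s \<in> Pi\<^sub>E I S. s i = x} = Pi\<^sub>E I ?S"
    using assms(3,4) by (auto simp: PiE_iff extensional_def split: if_splits)
  then have "(\<Sum>s\<in>{s \<in> Pi\<^sub>E I S. s i = x}. \<Prod>k\<in>I. f k (s k)) = (\<Prod>k\<in>I. \<Sum>y\<in>?S k. f k y)"
    using assms(1,2) by (subst prod_sum_PiE) auto
  also have "\<dots> = (\<Sum>y\<in>?S i. f i y) * (\<Prod>k\<in>I - {i}. \<Sum>y\<in>?S k. f k y)"
    using assms(1,3) by (rule prod.remove)
  also have "(\<Prod>k\<in>I - {i}. \<Sum>y\<in>?S k. f k y) = 1"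
    by (intro prod.neutral) (auto simp: one)
  finally show ?thesis by simp
qed

text \<open>Gaussian elimination, one equation at a time: a pivot \<open>p\<close> of equation
  \<open>e\<close> is eliminated from the remaining equations, which leaves one equation and one
  unknown fewer.\<close>

lemma homogeneous_system_nontrivial_solution:
  fixes a :: "'e \<Rightarrow> 'k \<Rightarrow> 'f::field"
  assumes "finite E" "finite K" "card E < card K"
  shows "\<exists>v. (\<exists>k\<in>K. v k \<noteq> 0) \<and> (\<forall>e\<in>E. (\<Sum>k\<in>K. a e k * v k) = 0)"
  using assms
proof (induction E arbitrary: K a rule: finite_induct)
  case empty
  then obtain k where "k \<in> K" by fastforce
  then show ?case by (intro exI[of _ "\<lambda>_. 1"]) auto
next
  case (insert e E)
  show ?case
  proof (cases "\<forall>k\<in>K. a e k = 0")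
    case True
    obtain v where "\<exists>k\<in>K. v k \<noteq> 0" "\<forall>e\<in>E. (\<Sum>k\<in>K. a e k * v k) = 0"
      using insert.IH[of K a] insert.prems insert.hyps by auto
    with True show ?thesis by (intro exI[of _ v]) simp
  next
    case False
    then obtain p where p: "p \<in> K" "a e p \<noteq> 0" by blast
    have "card E < card (K - {p})"
      using p insert.prems insert.hyps by simp
    then obtain v where v: "\<exists>k\<in>K - {p}. v k \<noteq> 0"
      "\<And>e'. e' \<in> E \<Longrightarrow> (\<Sum>k\<in>K - {p}. (a e' k - a e' p * a e k / a e p) * v k) = 0"
      using insert.IH[of "K - {p}" "\<lambda>e' k. a e' k - a e' p * a e k / a e p"] insert.prems
      by auto
    \<comment> \<open>Back-substitution: this value of the pivot unknown makes equation
      \<open>e\<close> hold.\<close>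
    define c where "c = - (\<Sum>k\<in>K - {p}. a e k * v k) / a e p"
    have split: "(\<Sum>k\<in>K. a e' k * (v(p := c)) k) = a e' p * c + (\<Sum>k\<in>K - {p}. a e' k * v k)" for e'
      using p insert.prems by (simp add: sum.remove)
    have "(\<Sum>k\<in>K. a e' k * (v(p := c)) k) = 0" if "e' \<in> insert e E" for e'
    proof (cases "e' = e")
      case True
      show ?thesis unfolding True split[of e] using p by (simp add: c_def)
    next
      case False
      with that have "e' \<in> E" by simp
      from v(2)[OF this] have "(\<Sum>k\<in>K - {p}. a e' k * v k) =
          (\<Sum>k\<in>K - {p}. a e' p / a e p * (a e k * v k))"
        by (simp add: left_diff_distrib sum_subtractf mult.assoc)
      also have "\<dots> = - (a e' p * c)"
        unfolding sum_distrib_left[symmetric] by (simp add: c_def)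
      finally show ?thesis unfolding split by simp
    qed
    moreover have "\<exists>k\<in>K. (v(p := c)) k \<noteq> 0"
      using v(1) by auto
    ultimately show ?thesis by blast
  qed
qed

text \<open>Expanding each \<open>z - s i\<close> around the weighted mean, the cross terms cancel
  because the weights sum to 1. Hence the tuple cost is the minimum over \<open>z\<close> of the
  weighted squared distances.\<close>

lemma tuple_cost_add_norm_sq:
  fixes s :: "nat \<Rightarrow> 'a::euclidean_space"
  assumes "(\<Sum>i<n. lam i) = 1"
  shows "tuple_cost n lam s + (norm (z - weighted_mean n lam s))\<^sup>2 =
    (\<Sum>i<n. lam i * (norm (z - s i))\<^sup>2)"
proof -
  define m where "m = weighted_mean n lam s"
  have "(\<Sum>i<n. lam i * (norm (z - s i))\<^sup>2) =
      (\<Sum>i<n. lam i * (norm (m - s i))\<^sup>2 + lam i * (norm (z - m))\<^sup>2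
        + 2 * ((z - m) \<bullet> (lam i *\<^sub>R m - lam i *\<^sub>R s i)))"
  proof (intro sum.cong refl)
    fix i
    have "z - s i = (m - s i) + (z - m)" by simp
    then have *: "(norm (z - s i))\<^sup>2 =
        (norm (m - s i))\<^sup>2 + (norm (z - m))\<^sup>2 + 2 * ((z - m) \<bullet> (m - s i))"
      unfolding power2_norm_eq_inner
      by (simp only: inner_add_left inner_add_right inner_commute[of "m - s i" "z - m"])
    show "lam i * (norm (z - s i))\<^sup>2 = lam i * (norm (m - s i))\<^sup>2 + lam i * (norm (z - m))\<^sup>2
        + 2 * ((z - m) \<bullet> (lam i *\<^sub>R m - lam i *\<^sub>R s i))"
      unfolding * by (simp add: algebra_simps inner_diff_right)
  qed
  also have "\<dots> = tuple_cost n lam s + (\<Sum>i<n. lam i) * (norm (z - m))\<^sup>2 +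
      2 * ((z - m) \<bullet> ((\<Sum>i<n. lam i) *\<^sub>R m - m))"
    unfolding sum.distrib tuple_cost_def m_def[symmetric] sum_distrib_left[symmetric]
      sum_distrib_right[symmetric] inner_sum_right[symmetric] sum_subtractf scaleR_left.sum
    by (simp add: m_def weighted_mean_def)
  finally show ?thesis using assms by (simp add: m_def)
qed

lemma lookup_scaleR [simp]: "Poly_Mapping.lookup (r *\<^sub>R w) s = r *\<^sub>R Poly_Mapping.lookup w s"
proof -
  have "finite {s. r *\<^sub>R Poly_Mapping.lookup w s \<noteq> 0}"
    by (rule finite_subset[OF _ finite_lookup[of w]]) auto
  then show ?thesis by (simp add: scaleR_poly_mapping_def)
qed

section \<open>Discrete measures and disintegration of couplings\<close>

lemma emeasure_discrete_prob:
  fixes M :: "'a::euclidean_space measure"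
  assumes "discrete_prob M" "A \<in> sets borel"
  shows "emeasure M A = (\<Sum>x\<in>supp M. ennreal (measure M {x}) * indicator A x)"
proof -
  interpret prob_space M
    using assms by (simp add: discrete_prob_def borel_prob_def)
  have M: "sets M = sets borel" and fin: "finite (supp M)"
    using assms by (auto simp: discrete_prob_def borel_prob_def)
  have supp: "supp M \<in> sets M"
    using fin M by (simp add: finite_imp_closed)
  have "AE x in M. x \<in> supp M"
    using supp discrete_prob_supp(1)[OF assms(1)] by (simp add: AE_in_set_eq_1 emeasure_eq_measure)
  then have "emeasure M A = emeasure M (A \<inter> supp M)"
    using assms(2) supp M by (intro emeasure_eq_AE) auto
  also have "\<dots> = (\<Sum>x\<in>A \<inter> supp M. emeasure M {x})"
    using fin M by (intro emeasure_eq_sum_singleton) auto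
  also have "\<dots> = (\<Sum>x\<in>supp M. ennreal (measure M {x}) * indicator A x)"
    using fin by (intro sum.mono_neutral_cong_left) (auto simp: emeasure_eq_measure indicator_def)
  finally show ?thesis .
qed

text \<open>\<open>f y x\<close> plays the role of the conditional probability that the second
  component is \<open>y\<close>, given that the first is \<open>x\<close>.\<close>

lemma coupling_disintegration:
  fixes Q M :: "'a::euclidean_space measure"
  assumes Q: "borel_prob Q" and M: "discrete_prob M" and \<gamma>: "\<gamma> \<in> couplings Q M"
  obtains f :: "'a \<Rightarrow> 'a \<Rightarrow> ennreal" where
    "\<And>y. f y \<in> borel_measurable Q"
    "AE x in Q. (\<Sum>y\<in>supp M. f y x) = 1"
    "\<And>y. (\<integral>\<^sup>+ x. f y x \<partial>Q) = measure M {y}"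
    "(\<integral>\<^sup>+ x. (\<Sum>y\<in>supp M. ennreal ((norm (x - y))\<^sup>2) * f y x) \<partial>Q)
       \<le> (\<integral>\<^sup>+ (x, y). ennreal ((norm (x - y))\<^sup>2) \<partial>\<gamma>)"
proof -
  interpret Q: prob_space Q
    using Q by (simp add: borel_prob_def)
  interpret M: prob_space M
    using M by (simp add: discrete_prob_def borel_prob_def)
  have sQ [measurable_cong]: "sets Q = sets borel" and sM [measurable_cong]: "sets M = sets borel"
    and s\<gamma> [measurable_cong]: "sets \<gamma> = sets (borel \<Otimes>\<^sub>M borel)"
    and fst: "distr \<gamma> borel fst = Q" and snd: "distr \<gamma> borel snd = M"
    using Q M \<gamma> by (auto simp: borel_prob_def discrete_prob_def couplings_def)
  have fin: "finite (supp M)"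
    using M by (simp add: discrete_prob_def)
  have space_\<gamma>: "space \<gamma> = UNIV"
    using sets_eq_imp_space_eq[OF s\<gamma>] by (simp add: space_pair_measure)
  \<comment> \<open>The part of \<open>\<gamma>\<close> whose second component is \<open>y\<close>,
    projected to the first component.\<close>
  define \<mu> where "\<mu> y = distr (density \<gamma> (\<lambda>z. indicator {y} (snd z))) borel fst" for y
  have nn_\<mu>: "(\<integral>\<^sup>+ x. g x \<partial>\<mu> y) = (\<integral>\<^sup>+ z. g (fst z) * indicator {y} (snd z) \<partial>\<gamma>)"
    if [measurable]: "g \<in> borel_measurable borel" for g y
    unfolding \<mu>_def
    by (subst nn_integral_distr, simp_all) (subst nn_integral_density, auto simp: mult.commute)
  have nn_Q: "(\<integral>\<^sup>+ x. g x \<partial>Q) = (\<integral>\<^sup>+ z. g (fst z) \<partial>\<gamma>)"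
    if [measurable]: "g \<in> borel_measurable borel" for g
    unfolding fst[symmetric] by (subst nn_integral_distr) simp_all
  have nn_M: "(\<integral>\<^sup>+ y. g y \<partial>M) = (\<integral>\<^sup>+ z. g (snd z) \<partial>\<gamma>)"
    if [measurable]: "g \<in> borel_measurable borel" for g
    unfolding snd[symmetric] by (subst nn_integral_distr) simp_all
  have sets_\<mu> [measurable_cong]: "sets (\<mu> y) = sets borel" for y
    by (simp add: \<mu>_def)
  \<comment> \<open>Dropping the condition on the second component only enlarges the mass, and what
    remains is the first marginal \<open>Q\<close>.\<close>
  have ac: "absolutely_continuous Q (\<mu> y)" for y
    unfolding absolutely_continuous_def
  proof
    fix A assume A: "A \<in> null_sets Q"
    then have [measurable]: "A \<in> sets borel" by (auto simp: null_sets_def sQ)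
    have "emeasure (\<mu> y) A = (\<integral>\<^sup>+ z. indicator A (fst z) * indicator {y} (snd z) \<partial>\<gamma>)"
      using nn_\<mu>[of "indicator A" y] by (simp add: sets_\<mu>)
    also have "\<dots> \<le> (\<integral>\<^sup>+ z. indicator A (fst z) \<partial>\<gamma>)"
      by (intro nn_integral_mono) (auto simp: indicator_def)
    also have "\<dots> = emeasure Q A"
      using nn_Q[of "indicator A"] by (simp add: sQ)
    finally show "A \<in> null_sets (\<mu> y)"
      using A by (auto simp: null_sets_def sets_\<mu>)
  qed
  define f where "f y = RN_deriv Q (\<mu> y)" for y
  have f_meas [measurable]: "f y \<in> borel_measurable Q" for y
    by (simp add: f_def)
  have density_f: "density Q (f y) = \<mu> y" for y
    unfolding f_def by (intro Q.density_RN_deriv ac) (simp add: sets_\<mu> sQ)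
  have nn_f: "(\<integral>\<^sup>+ x. g x * f y x \<partial>Q) = (\<integral>\<^sup>+ z. g (fst z) * indicator {y} (snd z) \<partial>\<gamma>)"
    if [measurable]: "g \<in> borel_measurable borel" for g y
  proof -
    have "(\<integral>\<^sup>+ x. g x * f y x \<partial>Q) = (\<integral>\<^sup>+ x. g x \<partial>density Q (f y))"
      by (subst nn_integral_density) (simp_all add: mult.commute)
    then show ?thesis by (simp add: density_f nn_\<mu>)
  qed
  have snd_supp: "AE z in \<gamma>. snd z \<in> supp M"
  proof -
    have [measurable]: "supp M \<in> sets borel" using fin by (simp add: finite_imp_closed)
    have "AE y in M. y \<in> supp M"
      using discrete_prob_supp(1)[OF M] by (simp add: M.AE_in_set_eq_1 M.emeasure_eq_measure sM)
    then have "AE y in distr \<gamma> borel snd. y \<in> supp M" unfolding snd .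
    then show ?thesis by (subst (asm) AE_distr_iff) auto
  qed
  have sum_ind: "(\<Sum>y\<in>supp M. indicator {y} t) = (1::ennreal)" if "t \<in> supp M" for t
    using fin that by (simp add: indicator_def if_distrib sum.If_cases Collect_conv_if cong: if_cong)
  \<comment> \<open>The sum of the \<open>f y\<close> and the constant 1 have the same integral over
    every measurable set, so uniqueness of densities identifies them almost everywhere.\<close>
  have "AE x in Q. (\<Sum>y\<in>supp M. f y x) = 1"
  proof (rule Q.density_unique_finite_measure)
    fix A assume "A \<in> sets Q"
    then have [measurable]: "A \<in> sets borel" by (simp add: sQ)
    have "(\<integral>\<^sup>+ x. (\<Sum>y\<in>supp M. f y x) * indicator A x \<partial>Q) =
        (\<integral>\<^sup>+ x. (\<Sum>y\<in>supp M. indicator A x * f y x) \<partial>Q)"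
      by (simp add: sum_distrib_left mult.commute)
    also have "\<dots> = (\<Sum>y\<in>supp M. \<integral>\<^sup>+ x. indicator A x * f y x \<partial>Q)"
      by (intro nn_integral_sum) simp
    also have "\<dots> = (\<Sum>y\<in>supp M. \<integral>\<^sup>+ z. indicator A (fst z) * indicator {y} (snd z) \<partial>\<gamma>)"
      by (simp add: nn_f)
    also have "\<dots> = (\<integral>\<^sup>+ z. (\<Sum>y\<in>supp M. indicator A (fst z) * indicator {y} (snd z)) \<partial>\<gamma>)"
      by (intro nn_integral_sum[symmetric]) simp
    also have "\<dots> = (\<integral>\<^sup>+ z. indicator A (fst z) \<partial>\<gamma>)"
      using snd_supp by (intro nn_integral_cong_AE) (auto simp: sum_ind simp flip: sum_distrib_left)
    also have "\<dots> = (\<integral>\<^sup>+ x. 1 * indicator A x \<partial>Q)"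
      using nn_Q[of "indicator A"] by simp
    finally show "(\<integral>\<^sup>+ x. (\<Sum>y\<in>supp M. f y x) * indicator A x \<partial>Q) = (\<integral>\<^sup>+ x. 1 * indicator A x \<partial>Q)" .
  qed auto
  moreover have "(\<integral>\<^sup>+ x. f y x \<partial>Q) = measure M {y}" for y
    using nn_f[of "\<lambda>_. 1" y] nn_M[of "indicator {y}"] by (simp add: sM M.emeasure_eq_measure)
  moreover have "(\<integral>\<^sup>+ x. (\<Sum>y\<in>supp M. ennreal ((norm (x - y))\<^sup>2) * f y x) \<partial>Q)
       \<le> (\<integral>\<^sup>+ (x, y). ennreal ((norm (x - y))\<^sup>2) \<partial>\<gamma>)"
  proof -
    have "(\<integral>\<^sup>+ x. (\<Sum>y\<in>supp M. ennreal ((norm (x - y))\<^sup>2) * f y x) \<partial>Q) =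
        (\<Sum>y\<in>supp M. \<integral>\<^sup>+ x. ennreal ((norm (x - y))\<^sup>2) * f y x \<partial>Q)"
      by (intro nn_integral_sum) simp
    also have "\<dots> = (\<Sum>y\<in>supp M. \<integral>\<^sup>+ z. ennreal ((norm (fst z - y))\<^sup>2) * indicator {y} (snd z) \<partial>\<gamma>)"
      by (intro sum.cong refl nn_f) simp
    also have "\<dots> = (\<integral>\<^sup>+ z. (\<Sum>y\<in>supp M. ennreal ((norm (fst z - y))\<^sup>2) * indicator {y} (snd z)) \<partial>\<gamma>)"
      by (intro nn_integral_sum[symmetric]) simp
    \<comment> \<open>The indicator allows \<open>y\<close> to be replaced by \<open>snd z\<close>;
      the distance then no longer depends on \<open>y\<close>, and the indicators sum to 1 almost
      everywhere.\<close>
    also have "\<dots> = (\<integral>\<^sup>+ z. (\<Sum>y\<in>supp M. ennreal ((norm (fst z - snd z))\<^sup>2) * indicator {y} (snd z)) \<partial>\<gamma>)"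
      by (intro nn_integral_cong sum.cong) (auto simp: indicator_def)
    also have "\<dots> = (\<integral>\<^sup>+ z. ennreal ((norm (fst z - snd z))\<^sup>2) \<partial>\<gamma>)"
      using snd_supp by (intro nn_integral_cong_AE) (auto simp: sum_ind simp flip: sum_distrib_left)
    finally show ?thesis by (simp add: case_prod_unfold)
  qed
  ultimately show thesis
    using that f_meas by blast
qed

section \<open>The linear program\<close>

locale barycenter_lp =
  fixes n :: nat and lam :: "nat \<Rightarrow> real" and P :: "nat \<Rightarrow> 'a::euclidean_space measure"
  assumes discrete: "i < n \<Longrightarrow> discrete_prob (P i)"
    and lam_pos: "i < n \<Longrightarrow> 0 < lam i"
    and lam_sum: "(\<Sum>i<n. lam i) = 1"
begin

lemma n_pos: "0 < n"
  using lam_sum by (cases n) auto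

lemma finite_supp: "i < n \<Longrightarrow> finite (supp (P i))"
  using discrete by (auto simp: discrete_prob_def)

lemma finite_tuples: "finite (tuples n P)"
  unfolding tuples_def using finite_supp by (intro finite_PiE) auto

lemma tuples_coordinate: "s \<in> tuples n P \<Longrightarrow> i < n \<Longrightarrow> s i \<in> supp (P i)"
  by (auto simp: tuples_def)

lemma sum_tuples_by_coordinate:
  fixes f :: "(nat \<Rightarrow> 'a) \<Rightarrow> 'c::comm_monoid_add"
  assumes "i < n"
  shows "(\<Sum>s\<in>tuples n P. f s) = (\<Sum>x\<in>supp (P i). \<Sum>s\<in>tuples_at n P i x. f s)"
  unfolding tuples_at_def
  using finite_tuples finite_supp[OF assms] tuples_coordinate[OF _ assms]
  by (intro sum.group[symmetric]) auto

lemma lp_feasibleD: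
  assumes "w \<in> lp_feasible n P"
  shows "0 \<le> Poly_Mapping.lookup w s"
    and "i < n \<Longrightarrow> x \<in> supp (P i) \<Longrightarrow>
      (\<Sum>s\<in>tuples_at n P i x. Poly_Mapping.lookup w s) = measure (P i) {x}"
    and "s \<notin> tuples n P \<Longrightarrow> Poly_Mapping.lookup w s = 0"
proof -
  show *: "s \<notin> tuples n P \<Longrightarrow> Poly_Mapping.lookup w s = 0"
    using assms by (auto simp: lp_feasible_def in_keys_iff)
  show "0 \<le> Poly_Mapping.lookup w s"
    using assms * by (cases "s \<in> tuples n P") (auto simp: lp_feasible_def)
qed (use assms in \<open>auto simp: lp_feasible_def\<close>)

text \<open>The constraints of a single measure already add up to the total mass; index 0 is
  available by \<open>n_pos\<close>.\<close>

lemma lp_feasible_sum: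
  assumes "w \<in> lp_feasible n P"
  shows "(\<Sum>s\<in>tuples n P. Poly_Mapping.lookup w s) = 1"
proof -
  have "(\<Sum>s\<in>tuples n P. Poly_Mapping.lookup w s) = (\<Sum>x\<in>supp (P 0). measure (P 0) {x})"
    unfolding sum_tuples_by_coordinate[OF n_pos]
    by (intro sum.cong refl lp_feasibleD(2)[OF assms n_pos])
  then show ?thesis
    using discrete_prob_supp(3)[OF discrete[OF n_pos]] by simp
qed

section \<open>Compactness of the feasible set and existence of an optimum\<close>

text \<open>The same polyhedron inside the full function space, where the product topology supplies
  compactness and continuity of coordinates.\<close>

definition feasible_functions :: "((nat \<Rightarrow> 'a) \<Rightarrow> real) set" where
  "feasible_functions = {f. (\<forall>s. s \<notin> tuples n P \<longrightarrow> f s = 0) \<and>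
     (\<forall>i<n. \<forall>x\<in>supp (P i). (\<Sum>s\<in>tuples_at n P i x. f s) = measure (P i) {x}) \<and> (\<forall>s. 0 \<le> f s)}"

lemma lp_feasible_iff: "w \<in> lp_feasible n P \<longleftrightarrow> Poly_Mapping.lookup w \<in> feasible_functions"
proof
  assume w: "w \<in> lp_feasible n P"
  show "Poly_Mapping.lookup w \<in> feasible_functions"
    unfolding feasible_functions_def using lp_feasibleD[OF w] by blast
next
  assume "Poly_Mapping.lookup w \<in> feasible_functions"
  then show "w \<in> lp_feasible n P"
    unfolding feasible_functions_def lp_feasible_def by (auto simp: in_keys_iff subset_iff)
qed

lemma feasible_function_lookup:
  assumes "f \<in> feasible_functions"
  obtains w where "w \<in> lp_feasible n P" "Poly_Mapping.lookup w = f"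
proof -
  have "finite {s. f s \<noteq> 0}"
    using assms by (intro finite_subset[OF _ finite_tuples]) (auto simp: feasible_functions_def)
  then have "Poly_Mapping.lookup (Abs_poly_mapping f) = f"
    by simp
  with assms that show thesis
    by (metis lp_feasible_iff)
qed

text \<open>A closed subset of a product of compact sets: each entry lies in the unit interval
  because the entries are nonnegative with total 1, and entries outside \<open>tuples n P\<close>
  are confined to the singleton of 0.\<close>

lemma compact_feasible_functions: "compact feasible_functions"
proof -
  let ?C = "\<Pi>\<^sub>E s\<in>UNIV. if s \<in> tuples n P then {0..1} else {0 :: real}"
  have C: "compact ?C"
    unfolding compactin_euclidean_iff[symmetric] euclidean_product_topology[symmetric]
    by (subst compactin_PiE) (auto simp: compactin_euclidean_iff)
  have cont: "continuous_on UNIV (\<lambda>f :: _ \<Rightarrow> real. \<Sum>s\<in>A. f s)" for A :: "(nat \<Rightarrow> 'a) set"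
    by (intro continuous_on_sum[where f = "\<lambda>s f. f s"] continuous_on_product_coordinates)
  have coord: "continuous_on UNIV (\<lambda>f :: (nat \<Rightarrow> 'a) \<Rightarrow> real. f s)" for s
    by (rule continuous_on_product_coordinates)
  have "feasible_functions = (\<Inter>s\<in>- tuples n P. {f. f s = 0}) \<inter>
      (\<Inter>i\<in>{..<n}. \<Inter>x\<in>supp (P i). {f. (\<Sum>s\<in>tuples_at n P i x. f s) = measure (P i) {x}}) \<inter>
      (\<Inter>s. {f. 0 \<le> f s})"
    by (auto simp: feasible_functions_def)
  also have "closed \<dots>"
    by (intro closed_Int closed_INT ballI closed_Collect_eq closed_Collect_le cont coord
        continuous_on_const)
  finally have "closed feasible_functions" .
  moreover have "feasible_functions \<subseteq> ?C"
  proof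
    fix f assume f: "f \<in> feasible_functions"
    then obtain w where w: "w \<in> lp_feasible n P" "Poly_Mapping.lookup w = f"
      by (rule feasible_function_lookup)
    have "f s \<le> 1" if "s \<in> tuples n P" for s
      using member_le_sum[of s "tuples n P" f] that finite_tuples lp_feasible_sum[OF w(1)]
        lp_feasibleD(1)[OF w(1)] by (simp add: w)
    then show "f \<in> ?C"
      using f by (auto simp: feasible_functions_def)
  qed
  ultimately show ?thesis
    using C compact_Int_closed[of ?C feasible_functions] by (simp add: Int_absorb1)
qed

text \<open>The independent joint distribution of the \<open>P i\<close> satisfies all
  constraints.\<close>

lemma feasible_functions_nonempty: "feasible_functions \<noteq> {}"
proof -
  define f where "f s = (if s \<in> tuples n P then \<Prod>i<n. measure (P i) {s i} else 0)" for s
  have "(\<Sum>s\<in>tuples_at n P i x. f s) = measure (P i) {x}" if "i < n" "x \<in> supp (P i)" for i x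
  proof -
    have "(\<Sum>s\<in>tuples_at n P i x. f s) = (\<Sum>s\<in>tuples_at n P i x. \<Prod>i<n. measure (P i) {s i})"
      by (intro sum.cong) (auto simp: f_def tuples_at_def)
    also have "\<dots> = measure (P i) {x}"
      unfolding tuples_at_def tuples_def using that finite_supp discrete
      by (intro sum_prod_PiE_coordinate) (auto simp: discrete_prob_supp)
    finally show ?thesis .
  qed
  then have "f \<in> feasible_functions"
    by (auto simp: feasible_functions_def f_def intro!: prod_nonneg)
  then show ?thesis by blast
qed

lemma lp_optimal_iff:
  "lp_optimal n lam P w \<longleftrightarrow> w \<in> lp_feasible n P \<and>
     (\<forall>w'\<in>lp_feasible n P. lp_objective n lam P w \<le> lp_objective n lam P w')"
  by (auto simp: lp_optimal_def is_arg_min_linorder)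

text \<open>A continuous function attains its minimum on a nonempty compact set; the minimiser is
  carried back to a finitely supported function.\<close>

lemma lp_optimal_exists: "\<exists>w. lp_optimal n lam P w"
proof -
  let ?obj = "\<lambda>f :: (nat \<Rightarrow> 'a) \<Rightarrow> real. \<Sum>s\<in>tuples n P. tuple_cost n lam s * f s"
  have "continuous_on feasible_functions ?obj"
    by (rule continuous_on_subset[OF _ subset_UNIV])
      (intro continuous_on_sum continuous_on_mult continuous_on_const continuous_on_product_coordinates)
  then obtain f where f: "f \<in> feasible_functions" "\<And>g. g \<in> feasible_functions \<Longrightarrow> ?obj f \<le> ?obj g"
    using continuous_attains_inf[OF compact_feasible_functions feasible_functions_nonempty] by blast
  obtain w where "w \<in> lp_feasible n P" "Poly_Mapping.lookup w = f"
    using f(1) by (rule feasible_function_lookup)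
  then have "lp_optimal n lam P w"
    using f(2) by (auto simp: lp_optimal_iff lp_objective_def lp_feasible_iff)
  then show ?thesis ..
qed

section \<open>The LP value and the barycenter objective\<close>

lemma nn_integral_lp_measure:
  assumes "g \<in> borel_measurable borel"
  shows "(\<integral>\<^sup>+ x. g x \<partial>lp_measure n lam P w) =
    (\<Sum>s\<in>tuples n P. ennreal (Poly_Mapping.lookup w s) * g (weighted_mean n lam s))"
  unfolding lp_measure_def using finite_tuples assms
  by (subst nn_integral_distr) (auto simp: nn_integral_point_measure_finite measurable_point_measure_eq1
      space_point_measure)

lemma borel_prob_lp_measure:
  assumes "w \<in> lp_feasible n P"
  shows "borel_prob (lp_measure n lam P w)"
proof -
  have "emeasure (lp_measure n lam P w) (space (lp_measure n lam P w)) = 1"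
    using emeasure_lp_measure[OF finite_tuples, of UNIV lam w] lp_feasible_sum[OF assms]
      lp_feasibleD(1)[OF assms]
    by (simp add: lp_measure_def space_distr sum_ennreal)
  then show ?thesis
    unfolding borel_prob_def by (simp add: prob_spaceI) (simp add: lp_measure_def)
qed

lemma finite_second_moment_lp_measure: "finite_second_moment (lp_measure n lam P w)"
  unfolding finite_second_moment_def using finite_tuples
  by (subst nn_integral_lp_measure) (auto simp: ennreal_mult_less_top)

text \<open>If a tuple is drawn according to \<open>w\<close>, the joint law of its weighted mean
  and its \<open>i\<close>-th component is a coupling; the right-hand side is its transport
  cost.\<close>

lemma wasserstein2_sq_lp_measure_le:
  assumes w: "w \<in> lp_feasible n P" and i: "i < n"
  shows "wasserstein2_sq (lp_measure n lam P w) (P i) \<le>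
    (\<Sum>s\<in>tuples n P. ennreal (Poly_Mapping.lookup w s) *
       ennreal ((norm (weighted_mean n lam s - s i))\<^sup>2))"
proof -
  let ?M = "point_measure (tuples n P) (\<lambda>s. ennreal (Poly_Mapping.lookup w s))"
  let ?h = "\<lambda>s. (weighted_mean n lam s, s i)"
  let ?\<gamma> = "distr ?M (borel \<Otimes>\<^sub>M borel) ?h"
  have h: "?h \<in> measurable ?M (borel \<Otimes>\<^sub>M borel)"
    by (simp add: measurable_point_measure_eq1 space_pair_measure)
  have si: "(\<lambda>s. s i) \<in> measurable ?M borel"
    by (simp add: measurable_point_measure_eq1)
  \<comment> \<open>The second marginal is correct precisely by the LP constraints of index
    \<open>i\<close>.\<close>
  have "distr ?M borel (\<lambda>s. s i) = P i"
  proof (rule measure_eqI)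
    show "sets (distr ?M borel (\<lambda>s. s i)) = sets (P i)"
      using discrete[OF i] by (simp add: discrete_prob_def borel_prob_def)
    fix A assume "A \<in> sets (distr ?M borel (\<lambda>s. s i))"
    then have A: "A \<in> sets borel" by simp
    have "emeasure (distr ?M borel (\<lambda>s. s i)) A = (\<integral>\<^sup>+ x. indicator A x \<partial>distr ?M borel (\<lambda>s. s i))"
      using A by simp
    also have "\<dots> = (\<integral>\<^sup>+ s. indicator A (s i) \<partial>?M)"
      using si A by (intro nn_integral_distr) auto
    also have "\<dots> = (\<Sum>s\<in>tuples n P. ennreal (Poly_Mapping.lookup w s) * indicator A (s i))"
      using finite_tuples by (rule nn_integral_point_measure_finite)
    also have "\<dots> = (\<Sum>x\<in>supp (P i). \<Sum>s\<in>tuples_at n P i x.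
        ennreal (Poly_Mapping.lookup w s) * indicator A (s i))"
      by (rule sum_tuples_by_coordinate[OF i])
    also have "\<dots> = (\<Sum>x\<in>supp (P i). \<Sum>s\<in>tuples_at n P i x.
        ennreal (Poly_Mapping.lookup w s) * indicator A x)"
      by (intro sum.cong refl) (auto simp: tuples_at_def)
    also have "\<dots> = (\<Sum>x\<in>supp (P i). ennreal (measure (P i) {x}) * indicator A x)"
      using lp_feasibleD[OF w] i
      by (intro sum.cong refl) (simp add: sum_ennreal flip: sum_distrib_right)
    also have "\<dots> = emeasure (P i) A"
      using emeasure_discrete_prob[OF discrete[OF i] A] by simp
    finally show "emeasure (distr ?M borel (\<lambda>s. s i)) A = emeasure (P i) A" .
  qed
  then have "?\<gamma> \<in> couplings (lp_measure n lam P w) (P i)"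
    unfolding couplings_def lp_measure_def
    by (auto simp: distr_distr[OF _ h] comp_def)
  then have "wasserstein2_sq (lp_measure n lam P w) (P i) \<le>
      (\<integral>\<^sup>+ (x, y). ennreal ((norm (x - y))\<^sup>2) \<partial>?\<gamma>)"
    unfolding wasserstein2_sq_def by (rule INF_lower)
  also have "\<dots> = (\<integral>\<^sup>+ s. ennreal ((norm (weighted_mean n lam s - s i))\<^sup>2) \<partial>?M)"
    using h by (subst nn_integral_distr) auto
  finally show ?thesis
    using finite_tuples by (simp add: nn_integral_point_measure_finite)
qed

text \<open>Weighting the coupling bounds by \<open>lam i\<close> and exchanging the sums over
  indices and tuples assembles the tuple costs.\<close>

lemma barycenter_objective_lp_measure_le:
  assumes w: "w \<in> lp_feasible n P"
  shows "(\<Sum>i<n. ennreal (lam i) * wasserstein2_sq (lp_measure n lam P w) (P i)) \<le>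
    ennreal (lp_objective n lam P w)"
proof -
  let ?d = "\<lambda>s i. (norm (weighted_mean n lam s - s i))\<^sup>2"
  have w0: "0 \<le> Poly_Mapping.lookup w s" for s
    using lp_feasibleD(1)[OF w] .
  have "(\<Sum>i<n. ennreal (lam i) * wasserstein2_sq (lp_measure n lam P w) (P i)) \<le>
      (\<Sum>i<n. ennreal (lam i) * (\<Sum>s\<in>tuples n P. ennreal (Poly_Mapping.lookup w s) * ennreal (?d s i)))"
    by (intro sum_mono mult_left_mono wasserstein2_sq_lp_measure_le w) auto
  also have "\<dots> = (\<Sum>i<n. ennreal (\<Sum>s\<in>tuples n P. lam i * (Poly_Mapping.lookup w s * ?d s i)))"
    using lam_pos w0
    by (intro sum.cong refl)
      (simp add: sum_nonneg less_imp_le sum_ennreal flip: ennreal_mult sum_distrib_left)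
  also have "\<dots> = ennreal (\<Sum>i<n. \<Sum>s\<in>tuples n P. lam i * (Poly_Mapping.lookup w s * ?d s i))"
    using lam_pos w0 by (intro sum_ennreal sum_nonneg mult_nonneg_nonneg) (auto simp: less_imp_le)
  also have "(\<Sum>i<n. \<Sum>s\<in>tuples n P. lam i * (Poly_Mapping.lookup w s * ?d s i)) = lp_objective n lam P w"
    unfolding lp_objective_def tuple_cost_def
    by (subst sum.swap) (simp add: sum_distrib_left sum_distrib_right mult_ac)
  finally show ?thesis .
qed

section \<open>Lower bound: gluing couplings into a feasible point\<close>

lemma tuple_cost_nonneg: "0 \<le> tuple_cost n lam s"
  unfolding tuple_cost_def by (intro sum_nonneg mult_nonneg_nonneg) (auto simp: lam_pos less_imp_le)

lemma sum_prod_tuples_at: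
  fixes f :: "nat \<Rightarrow> 'a \<Rightarrow> ennreal"
  assumes "\<And>k. k < n \<Longrightarrow> (\<Sum>y\<in>supp (P k). f k y) = 1" "i < n" "x \<in> supp (P i)"
  shows "(\<Sum>s\<in>tuples_at n P i x. \<Prod>k<n. f k (s k)) = f i x"
  unfolding tuples_at_def tuples_def using assms finite_supp
  by (intro sum_prod_PiE_coordinate) auto

text \<open>The pointwise form of the lower bound, with \<open>z\<close> a point of the barycenter
  candidate and \<open>f k\<close> the conditional distribution of the \<open>k\<close>-th
  component. Replacing \<open>z\<close> by the weighted mean lowers the cost, and each distance term
  depends on one component only, so the other factors sum out.\<close>

lemma sum_tuple_cost_prod_le:
  fixes f :: "nat \<Rightarrow> 'a \<Rightarrow> ennreal"
  assumes f: "\<And>k. k < n \<Longrightarrow> (\<Sum>y\<in>supp (P k). f k y) = 1"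
  shows "(\<Sum>s\<in>tuples n P. ennreal (tuple_cost n lam s) * (\<Prod>k<n. f k (s k))) \<le>
    (\<Sum>i<n. ennreal (lam i) * (\<Sum>y\<in>supp (P i). ennreal ((norm (z - y))\<^sup>2) * f i y))"
proof -
  let ?p = "\<lambda>s. \<Prod>k<n. f k (s k)"
  have "(\<Sum>s\<in>tuples n P. ennreal (tuple_cost n lam s) * ?p s) \<le>
      (\<Sum>s\<in>tuples n P. (\<Sum>i<n. ennreal (lam i) * ennreal ((norm (z - s i))\<^sup>2)) * ?p s)"
  proof (intro sum_mono mult_right_mono)
    fix s
    have "tuple_cost n lam s \<le> (\<Sum>i<n. lam i * (norm (z - s i))\<^sup>2)"
      using tuple_cost_add_norm_sq[OF lam_sum, of s z] by (smt (verit) zero_le_power2)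
    then have "ennreal (tuple_cost n lam s) \<le> ennreal (\<Sum>i<n. lam i * (norm (z - s i))\<^sup>2)"
      by (rule ennreal_leI)
    also have "\<dots> = (\<Sum>i<n. ennreal (lam i * (norm (z - s i))\<^sup>2))"
      by (intro sum_ennreal[symmetric] mult_nonneg_nonneg) (auto simp: lam_pos less_imp_le)
    also have "\<dots> = (\<Sum>i<n. ennreal (lam i) * ennreal ((norm (z - s i))\<^sup>2))"
      using lam_pos by (intro sum.cong refl ennreal_mult) (auto simp: less_imp_le)
    finally show "ennreal (tuple_cost n lam s) \<le>
        (\<Sum>i<n. ennreal (lam i) * ennreal ((norm (z - s i))\<^sup>2))" .
  qed auto
  also have "\<dots> = (\<Sum>i<n. \<Sum>s\<in>tuples n P. ennreal (lam i) * (ennreal ((norm (z - s i))\<^sup>2) * ?p s))"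
    by (subst sum.swap) (simp add: sum_distrib_right mult.assoc)
  also have "\<dots> = (\<Sum>i<n. ennreal (lam i) * (\<Sum>y\<in>supp (P i). ennreal ((norm (z - y))\<^sup>2) * f i y))"
  proof (intro sum.cong refl)
    fix i assume "i \<in> {..<n}"
    then have i: "i < n" by simp
    have "(\<Sum>s\<in>tuples n P. ennreal (lam i) * (ennreal ((norm (z - s i))\<^sup>2) * ?p s)) =
        ennreal (lam i) *
          (\<Sum>y\<in>supp (P i). \<Sum>s\<in>tuples_at n P i y. ennreal ((norm (z - s i))\<^sup>2) * ?p s)"
      unfolding sum_distrib_left[symmetric] by (subst sum_tuples_by_coordinate[OF i]) simp
    also have "(\<Sum>y\<in>supp (P i). \<Sum>s\<in>tuples_at n P i y. ennreal ((norm (z - s i))\<^sup>2) * ?p s) =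
        (\<Sum>y\<in>supp (P i). ennreal ((norm (z - y))\<^sup>2) * (\<Sum>s\<in>tuples_at n P i y. ?p s))"
      unfolding sum_distrib_left by (intro sum.cong refl) (auto simp: tuples_at_def)
    also have "\<dots> = (\<Sum>y\<in>supp (P i). ennreal ((norm (z - y))\<^sup>2) * f i y)"
      using f i by (intro sum.cong refl) (simp add: sum_prod_tuples_at)
    finally show "(\<Sum>s\<in>tuples n P. ennreal (lam i) * (ennreal ((norm (z - s i))\<^sup>2) * ?p s)) =
        ennreal (lam i) * (\<Sum>y\<in>supp (P i). ennreal ((norm (z - y))\<^sup>2) * f i y)" .
  qed
  finally show ?thesis .
qed

text \<open>
  The couplings are glued along \<open>Q\<close>: given \<open>x\<close> distributed as \<open>Q\<close>, the components of the tuple are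
  drawn independently from the conditional distributions \<open>f i _ x\<close>.
\<close>

lemma couplings_dominate_lp:
  assumes Q: "borel_prob Q" and \<gamma>: "\<And>i. i < n \<Longrightarrow> \<gamma> i \<in> couplings Q (P i)"
  shows "\<exists>w\<in>lp_feasible n P. ennreal (lp_objective n lam P w) \<le>
    (\<Sum>i<n. ennreal (lam i) * (\<integral>\<^sup>+ (x, y). ennreal ((norm (x - y))\<^sup>2) \<partial>\<gamma> i))"
proof -
  \<comment> \<open>Bundled into one predicate so that a disintegration can be chosen for all
    indices at once.\<close>
  define disint where "disint i f \<longleftrightarrow> (\<forall>y. f y \<in> borel_measurable Q) \<and>
    (AE x in Q. (\<Sum>y\<in>supp (P i). f y x) = 1) \<and>
    (\<forall>y. (\<integral>\<^sup>+ x. f y x \<partial>Q) = measure (P i) {y}) \<and>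
    (\<integral>\<^sup>+ x. (\<Sum>y\<in>supp (P i). ennreal ((norm (x - y))\<^sup>2) * f y x) \<partial>Q)
       \<le> (\<integral>\<^sup>+ (x, y). ennreal ((norm (x - y))\<^sup>2) \<partial>\<gamma> i)" for i f
  have "\<exists>f. disint i f" if "i < n" for i
    by (rule coupling_disintegration[OF Q discrete[OF that] \<gamma>[OF that]])
      (auto simp: disint_def)
  then obtain f where "\<And>i. i < n \<Longrightarrow> disint i (f i)"
    by metis
  then have f: "\<And>i y. i < n \<Longrightarrow> f i y \<in> borel_measurable Q"
    "\<And>i. i < n \<Longrightarrow> AE x in Q. (\<Sum>y\<in>supp (P i). f i y x) = 1"
    "\<And>i y. i < n \<Longrightarrow> (\<integral>\<^sup>+ x. f i y x \<partial>Q) = measure (P i) {y}"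
    "\<And>i. i < n \<Longrightarrow> (\<integral>\<^sup>+ x. (\<Sum>y\<in>supp (P i). ennreal ((norm (x - y))\<^sup>2) * f i y x) \<partial>Q)
       \<le> (\<integral>\<^sup>+ (x, y). ennreal ((norm (x - y))\<^sup>2) \<partial>\<gamma> i)"
    by (simp_all add: disint_def)
  have sQ [measurable_cong]: "sets Q = sets borel"
    using Q by (simp add: borel_prob_def)
  \<comment> \<open>The exceptional null sets, one per index, are merged so that all conditional
    distributions are normalised at the same point.\<close>
  have AE1: "AE x in Q. \<forall>k<n. (\<Sum>y\<in>supp (P k). f k y x) = 1"
    using f(2) by (subst AE_all_countable) auto
  have prod_meas: "(\<lambda>x. \<Prod>k<n. f k (s k) x) \<in> borel_measurable Q" for s
    by (intro borel_measurable_prod_ennreal f(1)) auto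
  define W where "W s = (\<integral>\<^sup>+ x. (\<Prod>k<n. f k (s k) x) \<partial>Q)" for s
  have sum_W: "(\<Sum>s\<in>tuples_at n P i y. W s) = measure (P i) {y}" if "i < n" "y \<in> supp (P i)" for i y
  proof -
    have "(\<Sum>s\<in>tuples_at n P i y. W s) = (\<integral>\<^sup>+ x. (\<Sum>s\<in>tuples_at n P i y. \<Prod>k<n. f k (s k) x) \<partial>Q)"
      unfolding W_def by (intro nn_integral_sum[symmetric] prod_meas)
    also have "\<dots> = (\<integral>\<^sup>+ x. f i y x \<partial>Q)"
    proof (rule nn_integral_cong_AE)
      show "AE x in Q. (\<Sum>s\<in>tuples_at n P i y. \<Prod>k<n. f k (s k) x) = f i y x"
        using AE1
      proof eventually_elim
        case (elim x)
        then show ?case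
          using that by (intro sum_prod_tuples_at[where f = "\<lambda>k y. f k y x"]) auto
      qed
    qed
    finally show ?thesis using f(3) that by simp
  qed
  have fin_at: "finite (tuples_at n P i y)" for i y
    using finite_tuples by (simp add: tuples_at_def)
  \<comment> \<open>\<open>W s\<close> is one summand of a constraint whose value is a finite mass;
    hence the passage to reals below loses nothing.\<close>
  have W_le: "W s < \<top>" if s: "s \<in> tuples n P" for s
  proof -
    have "W s \<le> (\<Sum>s\<in>tuples_at n P 0 (s 0). W s)"
      using s fin_at by (intro member_le_sum) (auto simp: tuples_at_def)
    also have "\<dots> = measure (P 0) {s 0}"
      using s n_pos by (intro sum_W tuples_coordinate)
    finally show ?thesis by (simp add: le_less_trans)
  qed
  define g where "g s = (if s \<in> tuples n P then enn2real (W s) else 0)" for s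
  have ennreal_g: "ennreal (g s) = W s" if "s \<in> tuples n P" for s
    using W_le[OF that] that by (simp add: g_def)
  have g_nonneg: "0 \<le> g s" for s
    by (simp add: g_def)
  have "(\<Sum>s\<in>tuples_at n P i y. g s) = measure (P i) {y}" if "i < n" "y \<in> supp (P i)" for i y
  proof -
    have "ennreal (\<Sum>s\<in>tuples_at n P i y. g s) = (\<Sum>s\<in>tuples_at n P i y. ennreal (g s))"
      using g_nonneg by (simp add: sum_ennreal)
    also have "\<dots> = (\<Sum>s\<in>tuples_at n P i y. W s)"
      by (intro sum.cong refl ennreal_g) (auto simp: tuples_at_def)
    finally show ?thesis
      using g_nonneg by (simp add: sum_W that sum_nonneg)
  qed
  then have "g \<in> feasible_functions"
    by (auto simp: feasible_functions_def g_def)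
  then obtain w where w: "w \<in> lp_feasible n P" "Poly_Mapping.lookup w = g"
    by (rule feasible_function_lookup)
  have "ennreal (lp_objective n lam P w) = (\<Sum>s\<in>tuples n P. ennreal (tuple_cost n lam s * g s))"
    unfolding lp_objective_def w(2)
    by (intro sum_ennreal[symmetric] mult_nonneg_nonneg tuple_cost_nonneg g_nonneg)
  also have "\<dots> = (\<Sum>s\<in>tuples n P. ennreal (tuple_cost n lam s) * W s)"
    by (intro sum.cong refl) (simp add: ennreal_mult tuple_cost_nonneg g_nonneg ennreal_g)
  also have "\<dots> = (\<Sum>s\<in>tuples n P. \<integral>\<^sup>+ x. ennreal (tuple_cost n lam s) * (\<Prod>k<n. f k (s k) x) \<partial>Q)"
    unfolding W_def by (intro sum.cong refl nn_integral_cmult[symmetric] prod_meas)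
  also have "\<dots> = (\<integral>\<^sup>+ x. (\<Sum>s\<in>tuples n P. ennreal (tuple_cost n lam s) * (\<Prod>k<n. f k (s k) x)) \<partial>Q)"
    by (intro nn_integral_sum[symmetric] borel_measurable_times_ennreal prod_meas) auto
  also have "\<dots> \<le> (\<integral>\<^sup>+ x. (\<Sum>i<n. ennreal (lam i) *
      (\<Sum>y\<in>supp (P i). ennreal ((norm (x - y))\<^sup>2) * f i y x)) \<partial>Q)"
  proof (rule nn_integral_mono_AE)
    show "AE x in Q. (\<Sum>s\<in>tuples n P. ennreal (tuple_cost n lam s) * (\<Prod>k<n. f k (s k) x)) \<le>
        (\<Sum>i<n. ennreal (lam i) * (\<Sum>y\<in>supp (P i). ennreal ((norm (x - y))\<^sup>2) * f i y x))"
      using AE1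
    proof eventually_elim
      case (elim x)
      then show ?case
        by (intro sum_tuple_cost_prod_le[where f = "\<lambda>k y. f k y x"]) auto
    qed
  qed
  also have "\<dots> = (\<Sum>i<n. \<integral>\<^sup>+ x. ennreal (lam i) *
      (\<Sum>y\<in>supp (P i). ennreal ((norm (x - y))\<^sup>2) * f i y x) \<partial>Q)"
    by (intro nn_integral_sum borel_measurable_times_ennreal borel_measurable_sum f(1)) auto
  also have "\<dots> = (\<Sum>i<n. ennreal (lam i) *
      (\<integral>\<^sup>+ x. (\<Sum>y\<in>supp (P i). ennreal ((norm (x - y))\<^sup>2) * f i y x) \<partial>Q))"
    by (intro sum.cong refl nn_integral_cmult borel_measurable_sum borel_measurable_times_ennreal f(1))
      auto
  also have "\<dots> \<le> (\<Sum>i<n. ennreal (lam i) * (\<integral>\<^sup>+ (x, y). ennreal ((norm (x - y))\<^sup>2) \<partial>\<gamma> i))"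
    by (intro sum_mono mult_left_mono f(4)) auto
  finally show ?thesis using w(1) by blast
qed

text \<open>Couplings within \<open>e\<close> of the infimum stand in for optimal ones, so no
  attainment has to be shown; an infinite right-hand side is trivial.\<close>

lemma lp_optimal_le_barycenter_objective:
  assumes w: "lp_optimal n lam P w" and Q: "borel_prob Q"
  shows "ennreal (lp_objective n lam P w) \<le> (\<Sum>i<n. ennreal (lam i) * wasserstein2_sq Q (P i))"
proof (rule ennreal_le_epsilon)
  fix e :: real
  assume finite: "(\<Sum>i<n. ennreal (lam i) * wasserstein2_sq Q (P i)) < \<top>" and e: "0 < e"
  have "\<exists>\<gamma>\<in>couplings Q (P i). (\<integral>\<^sup>+ (x, y). ennreal ((norm (x - y))\<^sup>2) \<partial>\<gamma>) \<le>
      wasserstein2_sq Q (P i) + ennreal e" if i: "i < n" for i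
  proof -
    have "ennreal (lam i) * wasserstein2_sq Q (P i) < \<top>"
      using finite i by simp
    \<comment> \<open>Positivity of \<open>lam i\<close> transfers finiteness from the weighted term
      to the distance itself, which makes adding \<open>e\<close> a strict increase.\<close>
    then have "wasserstein2_sq Q (P i) < \<top>"
      using lam_pos[OF i] by (auto simp: ennreal_mult_less_top)
    then have "wasserstein2_sq Q (P i) < wasserstein2_sq Q (P i) + ennreal e"
      using e by (simp add: ennreal_add_left_cancel_less add_pos_pos less_top)
    then show ?thesis
      unfolding wasserstein2_sq_def by (subst (asm) INF_less_iff) (auto intro: less_imp_le)
  qed
  then obtain \<gamma> where \<gamma>: "\<And>i. i < n \<Longrightarrow> \<gamma> i \<in> couplings Q (P i)"
    "\<And>i. i < n \<Longrightarrow> (\<integral>\<^sup>+ (x, y). ennreal ((norm (x - y))\<^sup>2) \<partial>\<gamma> i) \<le>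
      wasserstein2_sq Q (P i) + ennreal e"
    by metis
  obtain w' where w': "w' \<in> lp_feasible n P" "ennreal (lp_objective n lam P w') \<le>
    (\<Sum>i<n. ennreal (lam i) * (\<integral>\<^sup>+ (x, y). ennreal ((norm (x - y))\<^sup>2) \<partial>\<gamma> i))"
    using couplings_dominate_lp[OF Q \<gamma>(1)] by blast
  have "ennreal (lp_objective n lam P w) \<le> ennreal (lp_objective n lam P w')"
    using w w'(1) by (intro ennreal_leI) (auto simp: lp_optimal_iff)
  also note w'(2)
  also have "(\<Sum>i<n. ennreal (lam i) * (\<integral>\<^sup>+ (x, y). ennreal ((norm (x - y))\<^sup>2) \<partial>\<gamma> i)) \<le>
      (\<Sum>i<n. ennreal (lam i) * (wasserstein2_sq Q (P i) + ennreal e))"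
    using \<gamma>(2) by (intro sum_mono mult_left_mono) auto
  also have "\<dots> = (\<Sum>i<n. ennreal (lam i) * wasserstein2_sq Q (P i)) + (\<Sum>i<n. ennreal (lam i)) * ennreal e"
    by (simp add: distrib_left sum.distrib sum_distrib_right)
  \<comment> \<open>The errors are averaged with weights of total 1, so they amount to exactly
    \<open>e\<close>.\<close>
  also have "(\<Sum>i<n. ennreal (lam i)) = 1"
    using lam_pos lam_sum by (subst sum_ennreal) (auto simp: less_imp_le)
  finally show "ennreal (lp_objective n lam P w) \<le>
      (\<Sum>i<n. ennreal (lam i) * wasserstein2_sq Q (P i)) + ennreal e" by simp
qed

text \<open>The optimal LP value separates the objective of the induced measure from that of any
  competitor.\<close>

lemma barycenter_lp_measure:
  assumes w: "lp_optimal n lam P w"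
  shows "barycenter n lam P (lp_measure n lam P w)"
proof -
  have "w \<in> lp_feasible n P" using w by (simp add: lp_optimal_iff)
  then show ?thesis
    unfolding barycenter_def is_arg_min_linorder
    using borel_prob_lp_measure finite_second_moment_lp_measure
      order_trans[OF barycenter_objective_lp_measure_le lp_optimal_le_barycenter_objective[OF w]]
    by blast
qed

section \<open>Sparsity of vertices\<close>

text \<open>The complement of this finite set of means is open and has mass 0, so it contains no
  support point.\<close>

lemma supp_lp_measure_subset:
  assumes "w \<in> lp_feasible n P"
  shows "supp (lp_measure n lam P w) \<subseteq> weighted_mean n lam ` Poly_Mapping.keys w"
proof
  fix x assume x: "x \<in> supp (lp_measure n lam P w)"
  show "x \<in> weighted_mean n lam ` Poly_Mapping.keys w"
  proof (rule ccontr)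
    assume x': "x \<notin> weighted_mean n lam ` Poly_Mapping.keys w"
    let ?U = "- (weighted_mean n lam ` Poly_Mapping.keys w)"
    have U: "open ?U"
      by (intro open_Compl finite_imp_closed) simp
    have "Poly_Mapping.lookup w s = 0" if "weighted_mean n lam s \<in> ?U" for s
      using that by (auto simp: in_keys_iff)
    then have "emeasure (lp_measure n lam P w) ?U = 0"
      using U by (subst emeasure_lp_measure[OF finite_tuples])
        (auto intro!: sum.neutral split: split_indicator simp del: Compl_iff)
    with x x' U show False
      by (force simp: supp_def)
  qed
qed

text \<open>
  Since the constraints of each \<open>i\<close> add up to the same equation, for \<open>i > 0\<close> the constraint at one
  support point \<open>c i\<close> is redundant, which leaves the claimed number of equations.
\<close>

lemma card_keys_extreme_point:
  assumes w: "w extreme_point_of lp_feasible n P"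
  shows "int (card (Poly_Mapping.keys w)) \<le> (\<Sum>i<n. int (card (supp (P i)))) - int n + 1"
proof (rule ccontr)
  assume large: "\<not> ?thesis"
  have feas: "w \<in> lp_feasible n P"
    using w by (simp add: extreme_point_of_def)
  let ?K = "Poly_Mapping.keys w"
  have K: "?K \<subseteq> tuples n P"
    using feas by (simp add: lp_feasible_def)
  have nonempty: "supp (P i) \<noteq> {}" if "i < n" for i
    using discrete_prob_supp(3)[OF discrete[OF that]] by auto
  define c where "c i = (SOME x. x \<in> supp (P i))" for i
  have c: "c i \<in> supp (P i)" if "i < n" for i
    using nonempty[OF that] unfolding c_def by (simp add: some_in_eq)
  \<comment> \<open>Index 0 keeps all its constraints: they fix the total mass, from which the
    dropped ones are recovered.\<close>
  define S where "S i = (if i = 0 then supp (P i) else supp (P i) - {c i})" for i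
  define E where "E = Sigma {..<n} S"
  have finS: "finite (S i)" if "i < n" for i
    using finite_supp[OF that] by (auto simp: S_def)
  have finE: "finite E"
    using finS by (auto simp: E_def)
  have "int (card E) = (\<Sum>i<n. int (card (S i)))"
    using finS by (simp add: E_def)
  also have "\<dots> = (\<Sum>i<n. int (card (supp (P i))) - (if i = 0 then 0 else 1))"
  proof (intro sum.cong refl)
    fix i assume "i \<in> {..<n}"
    then have "i < n" by simp
    then show "int (card (S i)) = int (card (supp (P i))) - (if i = 0 then 0 else 1)"
      using c[of i] finite_supp[of i] card_Suc_Diff1[of "supp (P i)" "c i"]
      by (auto simp: S_def)
  qed
  also have "\<dots> = (\<Sum>i<n. int (card (supp (P i)))) - int n + 1"
  proof -
    have "(\<Sum>i<n. if i = 0 then 0 else 1 :: int) = int n - 1"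
      using n_pos by (cases n) (simp_all add: lessThan_Suc_eq_insert_0 sum.reindex)
    then show ?thesis by (simp add: sum_subtractf)
  qed
  finally have "card E < card ?K" using large by simp
  \<comment> \<open>More nonzero entries than equations: some nonzero vector on the keys of
    \<open>w\<close> solves the homogeneous system.\<close>
  then obtain v where v: "\<exists>s\<in>?K. v s \<noteq> 0"
    "\<And>i x. i < n \<Longrightarrow> x \<in> S i \<Longrightarrow> (\<Sum>s\<in>?K. (if s i = x then 1 else 0) * v s) = (0::real)"
    using homogeneous_system_nontrivial_solution[OF finE finite_keys[of w],
        of "\<lambda>(i, x) s. if s i = x then 1 else 0 :: real"] by (auto simp: E_def)
  define u where "u s = (if s \<in> ?K then v s else 0)" for s
  have sum_at: "(\<Sum>s\<in>tuples_at n P i x. u s) = (\<Sum>s\<in>?K. (if s i = x then 1 else 0) * v s)" for i x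
  proof -
    have "(\<Sum>s\<in>tuples_at n P i x. u s) = (\<Sum>s\<in>{s \<in> ?K. s i = x}. v s)"
      using K finite_tuples by (intro sum.mono_neutral_cong_right) (auto simp: tuples_at_def u_def)
    also have "\<dots> = (\<Sum>s\<in>?K. if s i = x then v s else 0)"
      by (simp add: sum.If_cases Int_def)
    also have "\<dots> = (\<Sum>s\<in>?K. (if s i = x then 1 else 0) * v s)"
      by (intro sum.cong) auto
    finally show ?thesis .
  qed
  have u0: "(\<Sum>s\<in>tuples_at n P i x. u s) = 0" if "i < n" "x \<in> S i" for i x
    using v(2)[OF that] by (simp add: sum_at)
  \<comment> \<open>All constraints of index 0 are in the system, so the perturbation has total mass
    0; subtracting the retained constraints of index \<open>i\<close> then yields the one at
    \<open>c i\<close>.\<close>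
  have total: "(\<Sum>s\<in>tuples n P. u s) = 0"
    unfolding sum_tuples_by_coordinate[OF n_pos] using u0[OF n_pos] by (simp add: S_def)
  have u_at: "(\<Sum>s\<in>tuples_at n P i x. u s) = 0" if i: "i < n" and x: "x \<in> supp (P i)" for i x
  proof (cases "x \<in> S i")
    case False
    with x have x: "x = c i" and S: "S i = supp (P i) - {c i}"
      by (auto simp: S_def split: if_splits)
    have "0 = (\<Sum>y\<in>supp (P i). \<Sum>s\<in>tuples_at n P i y. u s)"
      using total sum_tuples_by_coordinate[OF i, of u] by simp
    also have "\<dots> = (\<Sum>s\<in>tuples_at n P i x. u s) + (\<Sum>y\<in>S i. \<Sum>s\<in>tuples_at n P i y. u s)"
      using c[OF i] finite_supp[OF i] by (simp add: x S sum.remove)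
    also have "(\<Sum>y\<in>S i. \<Sum>s\<in>tuples_at n P i y. u s) = 0"
      using u0 i by (intro sum.neutral) auto
    finally show ?thesis by simp
  qed (use u0 i in auto)
  obtain d where d: "0 < d" "\<And>s. s \<in> ?K \<Longrightarrow> d * \<bar>v s\<bar> \<le> Poly_Mapping.lookup w s"
  proof -
    \<comment> \<open>\<open>B\<close> is the largest ratio of perturbation to entry, positive since
      \<open>v\<close> is nonzero. The step \<open>1 / B\<close> is small enough to keep every entry
      nonnegative in both directions.\<close>
    define B where "B = Max ((\<lambda>s. \<bar>v s\<bar> / Poly_Mapping.lookup w s) ` ?K)"
    have pos: "0 < Poly_Mapping.lookup w s" if "s \<in> ?K" for s
      using that lp_feasibleD(1)[OF feas, of s] by (simp add: in_keys_iff less_le)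
    have B: "\<bar>v s\<bar> / Poly_Mapping.lookup w s \<le> B" if "s \<in> ?K" for s
      unfolding B_def using that by (intro Max_ge) auto
    obtain s0 where s0: "s0 \<in> ?K" "v s0 \<noteq> 0" using v(1) by blast
    then have "0 < B"
      using B[of s0] pos[of s0] by (intro less_le_trans[OF _ B[of s0]]) auto
    then show thesis
      using B pos by (intro that[of "1 / B"]) (auto simp: field_simps)
  qed
  have "finite {s. u s \<noteq> 0}"
    by (rule finite_subset[of _ ?K]) (auto simp: u_def)
  then obtain p where p: "Poly_Mapping.lookup p = u"
    using lookup_Abs_poly_mapping by blast
  have "p \<noteq> 0"
    using v(1) by (auto simp: poly_mapping_eq_iff p u_def fun_eq_iff)
  have perturb: "w + r *\<^sub>R p \<in> lp_feasible n P" if r: "\<bar>r\<bar> = d" for r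
  proof -
    have "0 \<le> Poly_Mapping.lookup w s + r * u s" for s
    proof (cases "s \<in> ?K")
      case True
      have "\<bar>r * v s\<bar> \<le> Poly_Mapping.lookup w s"
        using d(2)[OF True] r by (simp add: abs_mult)
      then show ?thesis using True by (simp add: u_def)
    qed (use lp_feasibleD(1)[OF feas] in \<open>simp add: u_def\<close>)
    moreover have "Poly_Mapping.lookup w s + r * u s = 0" if "s \<notin> tuples n P" for s
      using that K lp_feasibleD(3)[OF feas] by (auto simp: u_def)
    ultimately show ?thesis
      using lp_feasibleD(2)[OF feas] u_at
      unfolding lp_feasible_iff feasible_functions_def
      by (auto simp: lookup_add p sum.distrib simp flip: sum_distrib_left)
  qed
  \<comment> \<open>\<open>w\<close> lies strictly between two distinct feasible points,
    contradicting extremality.\<close>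
  have "w = midpoint (w + d *\<^sub>R p) (w + (- d) *\<^sub>R p)"
    by (simp add: midpoint_def algebra_simps flip: scaleR_2)
  moreover have "w + d *\<^sub>R p \<noteq> w + (- d) *\<^sub>R p"
  proof
    assume "w + d *\<^sub>R p = w + (- d) *\<^sub>R p"
    then have "d *\<^sub>R p = (- d) *\<^sub>R p" by (rule add_left_imp_eq)
    then show False using d(1) \<open>p \<noteq> 0\<close> unfolding scaleR_cancel_right by simp
  qed
  ultimately have "w \<in> open_segment (w + d *\<^sub>R p) (w + (- d) *\<^sub>R p)"
    by (metis midpoint_in_open_segment)
  then show False
    using w perturb[of d] perturb[of "- d"] d(1) by (auto simp: extreme_point_of_def)
qed

text \<open>Different tuples may share a weighted mean, so the number of keys bounds the support
  size from above.\<close>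

lemma sparse_barycenter_lp_measure:
  assumes "lp_optimal n lam P w" "w extreme_point_of lp_feasible n P"
  shows "sparse_barycenter n lam P (lp_measure n lam P w)"
proof -
  have sub: "supp (lp_measure n lam P w) \<subseteq> weighted_mean n lam ` Poly_Mapping.keys w"
    using assms(1) by (intro supp_lp_measure_subset) (simp add: lp_optimal_iff)
  have "card (supp (lp_measure n lam P w)) \<le> card (Poly_Mapping.keys w)"
    using card_mono[OF _ sub] card_image_le[of "Poly_Mapping.keys w" "weighted_mean n lam"] by simp
  then show ?thesis
    unfolding sparse_barycenter_def
    using card_keys_extreme_point[OF assms(2)] barycenter_lp_measure[OF assms(1)]
      finite_subset[OF sub] by auto
qed

end

theorem theorem2:
  fixes P :: "nat \<Rightarrow> (real ^ 'd) measure" and lam :: "nat \<Rightarrow> real" and n :: nat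
  assumes "\<forall>i<n. discrete_prob (P i)"
    and "\<forall>i<n. 0 < lam i"
    and "(\<Sum>i<n. lam i) = 1"
  shows "(\<exists>w. lp_optimal n lam P w) \<and>
    (\<forall>w. lp_optimal n lam P w \<longrightarrow> barycenter n lam P (lp_measure n lam P w)) \<and>
    (\<forall>w. lp_optimal n lam P w \<and> w extreme_point_of lp_feasible n P \<longrightarrow>
       sparse_barycenter n lam P (lp_measure n lam P w))"
proof -
  interpret barycenter_lp n lam P
    using assms by unfold_locales auto
  show ?thesis
    using lp_optimal_exists barycenter_lp_measure sparse_barycenter_lp_measure by blast
qed

end
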